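(* Let $G$ be a graph, $S$ a symmetry group in dimension $d$, and $\Phi:S\to\mathrm{Aut}(G)$ a map. Let $(G,p)\in\mathscr{R}_{(G,S,\Phi)}$ and $x\in S$. Then $\Phi(x)\mathrm{Aut}(G,p)=\mathrm{Aut}(G,p)\Phi(x)$, and an automorphism $\alpha$ of $G$ satisfies $x(p(v))=p(\alpha(v))$ for all $v\in V(G)$ if and only if $\alpha\in\Phi(x)\mathrm{Aut}(G,p)$.
   Context: Graphs are finite, simple, with nonempty vertex set. $\mathrm{Aut}(G)$ is the group (under composition) of automorphisms of $G$. A framework in $\mathbb{R}^d$ (also called a $d$-dimensional realization of $G$) is a pair $(G,p)$ with $G$ a graph and $p:V(G)\to\mathbb{R}^d$ a map with $p(u)\neq p(v)$ whenever $\{u,v\}\in E(G)$; $p$ need not be injective. A symmetry operation of $(G,p)$ is an isometry $x$ of $\mathbb{R}^d$ such that for some $\alpha\in\mathrm{Aut}(G)$, $x(p(v))=p(\alpha(v))$ for all $v\in V(G)$. The point group of $(G,p)$ is the group of all its symmetry operations. A symmetry group in dimension $d$ is a subgroup of the orthogonal group $O(\mathbb{R}^d)$. $\mathscr{R}_{(G,S)}$ is the set of all $d$-dimensional realizations of $G$ whose point group equals $S$ or contains $S$ as a subgroup. For a map $\Phi:S\to\mathrm{Aut}(G)$ (not necessarily a homomorphism), $\mathscr{R}_{(G,S,\Phi)}$ is the set of all $(G,p)\in\mathscr{R}_{(G,S)}$ with $x(p(v))=p(\Phi(x)(v))$ for all $v\in V(G)$ and all $x\in S$. $\mathrm{Aut}(G,p)$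 denotes the set (a subgroup of $\mathrm{Aut}(G)$) of all $\alpha\in\mathrm{Aut}(G)$ with $p(v)=p(\alpha(v))$ for all $v\in V(G)$; $\Phi(x)\mathrm{Aut}(G,p)$ and $\mathrm{Aut}(G,p)\Phi(x)$ are its left and right cosets $\{\Phi(x)\circ\beta\}$ and $\{\beta\circ\Phi(x)\}$, $\beta\in\mathrm{Aut}(G,p)$. *)

theory Defs
  imports
    "HOL-Analysis.Analysis"
    "HOL-Algebra.Coset"
    "HOL-Algebra.Bij"
    "Graph_Theory.Pair_Digraph"
begin

text \<open>
  The locale \<open>pair_graph\<close> describes finite simple graphs: an undirected edge is stored as the two
  arcs \<open>(u, v)\<close> and \<open>(v, u)\<close>. It does not exclude the empty vertex set.
\<close>

definition nonempty_graph :: "'v pair_pre_digraph \<Rightarrow> bool" where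
  "nonempty_graph G \<longleftrightarrow> pair_graph G \<and> pverts G \<noteq> {}"

text \<open>
  Elements of \<open>Bij V\<close> are \<open>undefined\<close> outside \<open>V\<close>, so that each permutation of \<open>V\<close> is
  represented by exactly one function. The product of \<open>BijGroup V\<close> is composition on \<open>V\<close>.
\<close>

definition graph_aut :: "'v pair_pre_digraph \<Rightarrow> ('v \<Rightarrow> 'v) set" where
  "graph_aut G = {\<alpha> \<in> Bij (pverts G).
     \<forall>u \<in> pverts G. \<forall>v \<in> pverts G. (u, v) \<in> parcs G \<longleftrightarrow> (\<alpha> u, \<alpha> v) \<in> parcs G}"

definition Aut :: "'v pair_pre_digraph \<Rightarrow> ('v \<Rightarrow> 'v) monoid" where
  "Aut G = (BijGroup (pverts G)) \<lparr>carrier := graph_aut G\<rparr>"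

text \<open>
  A framework \<open>(G, p)\<close> is given by \<open>G\<close> together with a function \<open>p\<close> on the whole vertex type; the
  values of \<open>p\<close> outside \<open>pverts G\<close> are never used.
\<close>

definition framework :: "'v pair_pre_digraph \<Rightarrow> ('v \<Rightarrow> real ^ 'n) \<Rightarrow> bool" where
  "framework G p \<longleftrightarrow> (\<forall>u v. (u, v) \<in> parcs G \<longrightarrow> p u \<noteq> p v)"

definition isometry :: "(real ^ 'n \<Rightarrow> real ^ 'n) \<Rightarrow> bool" where
  "isometry x \<longleftrightarrow> (\<forall>a b. dist (x a) (x b) = dist a b)"

definition symmetry_operation ::
  "'v pair_pre_digraph \<Rightarrow> ('v \<Rightarrow> real ^ 'n) \<Rightarrow> (real ^ 'n \<Rightarrow> real ^ 'n) \<Rightarrow> bool" where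
  "symmetry_operation G p x \<longleftrightarrow>
     isometry x \<and> (\<exists>\<alpha> \<in> carrier (Aut G). \<forall>v \<in> pverts G. x (p v) = p (\<alpha> v))"

definition point_group ::
  "'v pair_pre_digraph \<Rightarrow> ('v \<Rightarrow> real ^ 'n) \<Rightarrow> (real ^ 'n \<Rightarrow> real ^ 'n) monoid" where
  "point_group G p = \<lparr>carrier = {x. symmetry_operation G p x}, mult = (\<circ>), one = id\<rparr>"

definition orthogonal_group :: "(real ^ 'n \<Rightarrow> real ^ 'n) monoid" where
  "orthogonal_group = \<lparr>carrier = {x. orthogonal_transformation x}, mult = (\<circ>), one = id\<rparr>"

definition symmetry_group :: "(real ^ 'n \<Rightarrow> real ^ 'n) set \<Rightarrow> bool" where
  "symmetry_group S \<longleftrightarrow> subgroup S orthogonal_group"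

text \<open>Since \<open>G\<close> is fixed, the realizations \<open>(G, p)\<close> are represented by their maps \<open>p\<close>.\<close>

definition realizations ::
  "'v pair_pre_digraph \<Rightarrow> (real ^ 'n \<Rightarrow> real ^ 'n) set \<Rightarrow> ('v \<Rightarrow> real ^ 'n) set" where
  "realizations G S = {p. framework G p \<and> subgroup S (point_group G p)}"

definition realizations_of_type ::
  "'v pair_pre_digraph \<Rightarrow> (real ^ 'n \<Rightarrow> real ^ 'n) set \<Rightarrow>
   ((real ^ 'n \<Rightarrow> real ^ 'n) \<Rightarrow> ('v \<Rightarrow> 'v)) \<Rightarrow> ('v \<Rightarrow> real ^ 'n) set" where
  "realizations_of_type G S \<Phi> =
     {p \<in> realizations G S. \<forall>x \<in> S. \<forall>v \<in> pverts G. x (p v) = p (\<Phi> x v)}"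

definition Aut_framework ::
  "'v pair_pre_digraph \<Rightarrow> ('v \<Rightarrow> real ^ 'n) \<Rightarrow> ('v \<Rightarrow> 'v) set" where
  "Aut_framework G p = {\<alpha> \<in> carrier (Aut G). \<forall>v \<in> pverts G. p v = p (\<alpha> v)}"

text \<open>
  The predicate \<open>subgroup\<close> and the coset operations are meaningful only relative to actual groups.
\<close>

lemma Aut_simps [simp]:
  "carrier (Aut G) = graph_aut G" "one (Aut G) = (\<lambda>v\<in>pverts G. v)"
  by (simp_all add: Aut_def BijGroup_def)

lemma mult_Aut [simp]:
  "\<alpha> \<in> graph_aut G \<Longrightarrow> \<beta> \<in> graph_aut G \<Longrightarrow> \<alpha> \<otimes>\<^bsub>Aut G\<^esub> \<beta> = compose (pverts G) \<alpha> \<beta>"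
  by (simp add: Aut_def BijGroup_def graph_aut_def)

lemma graph_aut_in_verts: "\<alpha> \<in> graph_aut G \<Longrightarrow> v \<in> pverts G \<Longrightarrow> \<alpha> v \<in> pverts G"
  by (auto simp: graph_aut_def dest: Bij_imp_funcset)

lemma graph_aut_compose:
  "\<alpha> \<in> graph_aut G \<Longrightarrow> \<beta> \<in> graph_aut G \<Longrightarrow> compose (pverts G) \<alpha> \<beta> \<in> graph_aut G"
  using graph_aut_in_verts[of \<beta> G] by (auto simp: graph_aut_def compose_Bij compose_eq)

lemma graph_aut_inv:
  assumes "\<alpha> \<in> graph_aut G"
  shows "restrict (inv_into (pverts G) \<alpha>) (pverts G) \<in> graph_aut G"
proof -
  have B: "\<alpha> \<in> Bij (pverts G)" and im: "\<alpha> ` pverts G = pverts G"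
    using assms by (auto simp: graph_aut_def Bij_def bij_betw_def)
  show ?thesis
    using assms B im restrict_inv_into_Bij[OF B]
    by (auto simp: graph_aut_def f_inv_into_f inv_into_into Bij_inv_into_mem)
qed

lemma group_Aut: "group (Aut G)"
proof -
  have "subgroup (graph_aut G) (BijGroup (pverts G))"
  proof (rule group.subgroupI[OF group_BijGroup])
    show "graph_aut G \<subseteq> carrier (BijGroup (pverts G))"
      by (auto simp: graph_aut_def BijGroup_def)
    show "graph_aut G \<noteq> {}"
      using id_Bij[of "pverts G"] by (auto simp: graph_aut_def intro!: exI[of _ "\<lambda>v\<in>pverts G. v"])
    show "inv\<^bsub>BijGroup (pverts G)\<^esub> \<alpha> \<in> graph_aut G" if "\<alpha> \<in> graph_aut G" for \<alpha>
      using graph_aut_inv[OF that] that by (simp add: inv_BijGroup graph_aut_def)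
    show "\<alpha> \<otimes>\<^bsub>BijGroup (pverts G)\<^esub> \<beta> \<in> graph_aut G"
      if "\<alpha> \<in> graph_aut G" "\<beta> \<in> graph_aut G" for \<alpha> \<beta>
      using graph_aut_compose[OF that] that by (simp add: BijGroup_def graph_aut_def)
  qed
  then show ?thesis
    unfolding Aut_def by (rule subgroup.subgroup_is_group) (rule group_BijGroup)
qed

lemma subgroup_Aut_framework: "subgroup (Aut_framework G p) (Aut G)"
proof (rule group.subgroupI[OF group_Aut])
  show "Aut_framework G p \<subseteq> carrier (Aut G)" by (auto simp: Aut_framework_def)
  show "Aut_framework G p \<noteq> {}"
    using group.is_monoid[OF group_Aut, THEN monoid.one_closed, of G]
    by (auto simp: Aut_framework_def intro!: exI[of _ "\<lambda>v\<in>pverts G. v"])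
  fix \<alpha> assume a: "\<alpha> \<in> Aut_framework G p"
  show "inv\<^bsub>Aut G\<^esub> \<alpha> \<in> Aut_framework G p"
  proof -
    have ag: "\<alpha> \<in> graph_aut G" and pa: "\<And>v. v \<in> pverts G \<Longrightarrow> p v = p (\<alpha> v)"
      using a by (auto simp: Aut_framework_def)
    let ?i = "inv\<^bsub>Aut G\<^esub> \<alpha>"
    have ig: "?i \<in> graph_aut G"
      using group.inv_closed[OF group_Aut, of \<alpha> G] ag by simp
    have "compose (pverts G) \<alpha> ?i = (\<lambda>v\<in>pverts G. v)"
      using group.r_inv[OF group_Aut, of \<alpha> G] ag ig by simp
    then have "\<alpha> (?i v) = v" if "v \<in> pverts G" for v
      using that by (metis compose_eq restrict_apply)
    then show ?thesis
      using ig pa graph_aut_in_verts[OF ig] by (auto simp: Aut_framework_def)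
  qed
  fix \<beta> assume b: "\<beta> \<in> Aut_framework G p"
  show "\<alpha> \<otimes>\<^bsub>Aut G\<^esub> \<beta> \<in> Aut_framework G p"
    using a b graph_aut_in_verts[of \<beta> G]
    by (auto simp: Aut_framework_def graph_aut_compose compose_eq)
qed

lemma group_orthogonal_group: "group (orthogonal_group :: (real ^ 'n \<Rightarrow> real ^ 'n) monoid)"
proof (rule groupI)
  fix x :: "real ^ 'n \<Rightarrow> real ^ 'n"
  assume "x \<in> carrier orthogonal_group"
  then have x: "orthogonal_transformation x" by (simp add: orthogonal_group_def)
  then show "\<exists>y \<in> carrier orthogonal_group. y \<otimes>\<^bsub>orthogonal_group\<^esub> x = \<one>\<^bsub>orthogonal_group\<^esub>"
    using orthogonal_transformation_inv[OF x] orthogonal_transformation_inj[OF x]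
    by (auto simp: orthogonal_group_def intro!: bexI[of _ "inv_into UNIV x"])
qed (auto simp: orthogonal_group_def orthogonal_transformation_compose
       orthogonal_transformation_id id_def comp_assoc)

lemma isometry_bij:
  fixes x :: "real ^ 'n \<Rightarrow> real ^ 'n"
  assumes "isometry x"
  shows "bij x"
proof -
  have "orthogonal_transformation (\<lambda>a. x a - x 0)"
    using assms by (simp add: orthogonal_transformation_isometry isometry_def dist_norm)
  then have "bij ((\<lambda>b. b + x 0) \<circ> (\<lambda>a. x a - x 0))"
    by (intro bij_comp orthogonal_transformation_bij bij_plus_right)
  then show ?thesis by (simp add: comp_def)
qed

lemma group_point_group: "group (point_group G p)"
proof (rule groupI)
  show "x \<otimes>\<^bsub>point_group G p\<^esub> y \<in> carrier (point_group G p)"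
    if "x \<in> carrier (point_group G p)" "y \<in> carrier (point_group G p)" for x y
  proof -
    obtain \<alpha> \<beta> where ab: "\<alpha> \<in> graph_aut G" "\<beta> \<in> graph_aut G"
      "\<forall>v\<in>pverts G. x (p v) = p (\<alpha> v)" "\<forall>v\<in>pverts G. y (p v) = p (\<beta> v)"
      using \<open>x \<in> _\<close> \<open>y \<in> _\<close> by (auto simp: point_group_def symmetry_operation_def)
    then show ?thesis
      using that graph_aut_compose[OF ab(1,2)] graph_aut_in_verts[of \<beta> G]
      by (auto simp: point_group_def symmetry_operation_def isometry_def compose_eq
          intro!: bexI[of _ "compose (pverts G) \<alpha> \<beta>"])
  qed
  show "\<one>\<^bsub>point_group G p\<^esub> \<in> carrier (point_group G p)"
    using group.is_monoid[OF group_Aut, THEN monoid.one_closed, of G]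
    by (auto simp: point_group_def symmetry_operation_def isometry_def
        intro!: bexI[of _ "\<lambda>v\<in>pverts G. v"])
  show "\<exists>y \<in> carrier (point_group G p). y \<otimes>\<^bsub>point_group G p\<^esub> x = \<one>\<^bsub>point_group G p\<^esub>"
    if xc: "x \<in> carrier (point_group G p)" for x
  proof -
    have iso: "isometry x" using xc by (auto simp: point_group_def symmetry_operation_def)
    obtain \<alpha> where a: "\<alpha> \<in> graph_aut G" "\<forall>v\<in>pverts G. x (p v) = p (\<alpha> v)"
      using xc by (auto simp: point_group_def symmetry_operation_def)
    let ?b = "restrict (inv_into (pverts G) \<alpha>) (pverts G)"
    have b: "?b \<in> graph_aut G" by (rule graph_aut_inv[OF a(1)])
    have bij: "bij x" by (rule isometry_bij[OF iso])
    have im: "\<alpha> ` pverts G = pverts G"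
      using a(1) by (auto simp: graph_aut_def Bij_def bij_betw_def)
    have "isometry (inv_into UNIV x)"
      using iso bij unfolding isometry_def by (metis bij_inv_eq_iff)
    moreover have "inv_into UNIV x (p v) = p (?b v)" if "v \<in> pverts G" for v
    proof -
      have "x (p (?b v)) = p v"
        using that a(2) im graph_aut_in_verts[OF b that] by (auto simp: f_inv_into_f)
      then show ?thesis
        using bij by (metis bij_inv_eq_iff)
    qed
    ultimately show ?thesis
      using b bij by (auto simp: point_group_def symmetry_operation_def bij_is_inj
          intro!: exI[of _ "inv_into UNIV x"] bexI[of _ ?b])
  qed
qed (auto simp: point_group_def comp_assoc)

end

theory Submission
  imports Defs
begin

text \<open>
  Both cosets equal the set of automorphisms \<open>\<alpha>\<close> with \<open>x \<circ> p = p \<circ> \<alpha>\<close>: two such automorphisms differ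
  by an element of \<open>Aut(G, p)\<close> on either side, where the left coset needs that \<open>x\<close> is injective.
\<close>

lemma mult_Aut_apply:
  "\<alpha> \<in> graph_aut G \<Longrightarrow> \<beta> \<in> graph_aut G \<Longrightarrow> v \<in> pverts G \<Longrightarrow> (\<alpha> \<otimes>\<^bsub>Aut G\<^esub> \<beta>) v = \<alpha> (\<beta> v)"
  by (simp add: compose_eq)

text \<open>In this form the two conjuncts can be extracted by resolution. As a rewrite rule,
  \<open>p v = p (\<alpha> v)\<close> could apply again to its own right-hand side.\<close>

lemma Aut_framework_iff:
  "\<alpha> \<in> Aut_framework G p \<longleftrightarrow> \<alpha> \<in> graph_aut G \<and> (\<forall>v\<in>pverts G. p v = p (\<alpha> v))"
  unfolding Aut_framework_def Aut_simps mem_Collect_eq by (rule refl)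

text \<open>An element \<eta> of Aut(G, p) acts before \<alpha>, so p(\<alpha>(\<eta> v)) =
  x(p(\<eta> v)) = x(p v). Conversely, \<gamma> = \<alpha>^-1 \<beta> satisfies x(p(\<gamma> v)) =
  p(\<beta> v) = x(p v), and x cancels.\<close>

lemma l_coset_Aut_framework:
  assumes "inj x" and a: "\<alpha> \<in> graph_aut G" and xa: "\<forall>v\<in>pverts G. x (p v) = p (\<alpha> v)"
  shows "\<alpha> <#\<^bsub>Aut G\<^esub> Aut_framework G p = {\<beta> \<in> graph_aut G. \<forall>v\<in>pverts G. x (p v) = p (\<beta> v)}"
proof (intro equalityI subsetI)
  fix \<beta> assume "\<beta> \<in> \<alpha> <#\<^bsub>Aut G\<^esub> Aut_framework G p"
  then obtain \<eta> where e: "\<eta> \<in> Aut_framework G p" and \<beta>: "\<beta> = \<alpha> \<otimes>\<^bsub>Aut G\<^esub> \<eta>"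
    unfolding l_coset_def by blast
  note h = e[unfolded Aut_framework_iff, THEN conjunct1]
    and ph = e[unfolded Aut_framework_iff, THEN conjunct2]
  have "p (\<alpha> (\<eta> v)) = x (p v)" if "v \<in> pverts G" for v
    using xa[rule_format, OF graph_aut_in_verts[OF h that]] ph[rule_format, OF that] by argo
  then show "\<beta> \<in> {\<beta> \<in> graph_aut G. \<forall>v\<in>pverts G. x (p v) = p (\<beta> v)}"
    using graph_aut_compose[OF a h] a h by (simp add: \<beta> compose_eq)
next
  fix \<beta> assume "\<beta> \<in> {\<beta> \<in> graph_aut G. \<forall>v\<in>pverts G. x (p v) = p (\<beta> v)}"
  then have b: "\<beta> \<in> graph_aut G" and xb: "\<And>v. v \<in> pverts G \<Longrightarrow> x (p v) = p (\<beta> v)" by auto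
  interpret group "Aut G" by (rule group_Aut)
  define \<gamma> where "\<gamma> = inv\<^bsub>Aut G\<^esub> \<alpha> \<otimes>\<^bsub>Aut G\<^esub> \<beta>"
  have c: "\<gamma> \<in> graph_aut G"
    using m_closed[of "inv\<^bsub>Aut G\<^esub> \<alpha>" \<beta>] inv_closed[of \<alpha>] a b by (simp add: \<gamma>_def del: mult_Aut)
  \<comment> \<open>\<open>inv_solve_left\<close> solves the definition of \<gamma> for \<beta>;
    with \<open>mult_Aut\<close> removed, the products keep the group-theoretic form in which this
    rule is stated.\<close>
  have eq: "\<beta> = \<alpha> \<otimes>\<^bsub>Aut G\<^esub> \<gamma>"
    using inv_solve_left[of \<gamma> \<alpha> \<beta>] a b c by (simp add: \<gamma>_def del: mult_Aut)
  have pc: "p v = p (\<gamma> v)" if v: "v \<in> pverts G" for v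
  proof -
    have "x (p (\<gamma> v)) = p (\<alpha> (\<gamma> v))" using xa graph_aut_in_verts[OF c v] by blast
    \<comment> \<open>Read at the vertex v, \<open>eq\<close> says \<alpha>(\<gamma> v) = \<beta>
      v.\<close>
    also have "\<dots> = x (p v)" using xb[OF v] mult_Aut_apply[OF a c v] eq by simp
    finally show ?thesis using \<open>inj x\<close> by (simp add: inj_eq)
  qed
  have "\<gamma> \<in> Aut_framework G p" unfolding Aut_framework_iff by (intro conjI ballI c pc)
  then show "\<beta> \<in> \<alpha> <#\<^bsub>Aut G\<^esub> Aut_framework G p" using eq unfolding l_coset_def by blast
qed

text \<open>Here \<eta> acts after \<alpha>, so p(\<eta>(\<alpha> v)) = p(\<alpha> v) = x(p v).
  Conversely, \<gamma> = \<beta> \<alpha>^-1 is tested at w = \<alpha> v: p(\<gamma> w) = p(\<beta>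
  v) = x(p v) = p w.\<close>

lemma r_coset_Aut_framework:
  assumes a: "\<alpha> \<in> graph_aut G" and xa: "\<forall>v\<in>pverts G. x (p v) = p (\<alpha> v)"
  shows "Aut_framework G p #>\<^bsub>Aut G\<^esub> \<alpha> = {\<beta> \<in> graph_aut G. \<forall>v\<in>pverts G. x (p v) = p (\<beta> v)}"
proof (intro equalityI subsetI)
  fix \<beta> assume "\<beta> \<in> Aut_framework G p #>\<^bsub>Aut G\<^esub> \<alpha>"
  then obtain \<eta> where e: "\<eta> \<in> Aut_framework G p" and \<beta>: "\<beta> = \<eta> \<otimes>\<^bsub>Aut G\<^esub> \<alpha>"
    unfolding r_coset_def by blast
  note h = e[unfolded Aut_framework_iff, THEN conjunct1]
    and ph = e[unfolded Aut_framework_iff, THEN conjunct2]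
  have "p (\<eta> (\<alpha> v)) = x (p v)" if "v \<in> pverts G" for v
    using xa[rule_format, OF that] ph[rule_format, OF graph_aut_in_verts[OF a that]] by argo
  then show "\<beta> \<in> {\<beta> \<in> graph_aut G. \<forall>v\<in>pverts G. x (p v) = p (\<beta> v)}"
    using graph_aut_compose[OF h a] a h by (simp add: \<beta> compose_eq)
next
  fix \<beta> assume "\<beta> \<in> {\<beta> \<in> graph_aut G. \<forall>v\<in>pverts G. x (p v) = p (\<beta> v)}"
  then have b: "\<beta> \<in> graph_aut G" and xb: "\<And>v. v \<in> pverts G \<Longrightarrow> x (p v) = p (\<beta> v)" by auto
  interpret group "Aut G" by (rule group_Aut)
  define \<gamma> where "\<gamma> = \<beta> \<otimes>\<^bsub>Aut G\<^esub> inv\<^bsub>Aut G\<^esub> \<alpha>"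
  have c: "\<gamma> \<in> graph_aut G"
    using m_closed[of \<beta> "inv\<^bsub>Aut G\<^esub> \<alpha>"] inv_closed[of \<alpha>] a b by (simp add: \<gamma>_def del: mult_Aut)
  have eq: "\<beta> = \<gamma> \<otimes>\<^bsub>Aut G\<^esub> \<alpha>"
    using inv_solve_right[of \<gamma> \<beta> \<alpha>] a b c by (simp add: \<gamma>_def del: mult_Aut)
  have pc: "p w = p (\<gamma> w)" if "w \<in> pverts G" for w
  proof -
    \<comment> \<open>Since \<alpha> permutes the vertices, every vertex w has the form \<alpha> v,
      where \<open>eq\<close> determines the value of \<gamma>.\<close>
    have "w \<in> \<alpha> ` pverts G" using a that by (simp add: graph_aut_def Bij_def bij_betw_def)
    then obtain v where v: "v \<in> pverts G" and w: "w = \<alpha> v" by blast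
    have "p (\<gamma> w) = p (\<beta> v)" using mult_Aut_apply[OF c a v] eq w by simp
    also have "\<dots> = p w" using xa[rule_format, OF v] xb[OF v] w by argo
    finally show ?thesis by simp
  qed
  have "\<gamma> \<in> Aut_framework G p" unfolding Aut_framework_iff by (intro conjI ballI c pc)
  then show "\<beta> \<in> Aut_framework G p #>\<^bsub>Aut G\<^esub> \<alpha>" using eq unfolding r_coset_def by blast
qed

theorem theorem5p1:
  fixes G :: "'v pair_pre_digraph"
    and S :: "(real ^ 'n \<Rightarrow> real ^ 'n) set"
    and \<Phi> :: "(real ^ 'n \<Rightarrow> real ^ 'n) \<Rightarrow> ('v \<Rightarrow> 'v)"
    and p :: "'v \<Rightarrow> real ^ 'n"
    and x :: "real ^ 'n \<Rightarrow> real ^ 'n"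
  assumes "nonempty_graph G"
    and "symmetry_group S"
    and "\<Phi> \<in> S \<rightarrow> carrier (Aut G)"
    and "p \<in> realizations_of_type G S \<Phi>"
    and "x \<in> S"
  shows "\<Phi> x <#\<^bsub>Aut G\<^esub> Aut_framework G p = Aut_framework G p #>\<^bsub>Aut G\<^esub> \<Phi> x \<and>
    (\<forall>\<alpha> \<in> carrier (Aut G).
      (\<forall>v \<in> pverts G. x (p v) = p (\<alpha> v)) \<longleftrightarrow> \<alpha> \<in> \<Phi> x <#\<^bsub>Aut G\<^esub> Aut_framework G p)"
proof -
  \<comment> \<open>The injectivity of x comes from S being a subgroup of the orthogonal
    group.\<close>
  have "orthogonal_transformation x"
    using \<open>symmetry_group S\<close> \<open>x \<in> S\<close> subgroup.subset
    by (fastforce simp: symmetry_group_def orthogonal_group_def)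
  then have "inj x" by (rule orthogonal_transformation_inj)
  moreover have "\<Phi> x \<in> graph_aut G" using assms(3,5) by auto
  moreover have "\<forall>v\<in>pverts G. x (p v) = p (\<Phi> x v)"
    using assms(4,5) by (auto simp: realizations_of_type_def)
  \<comment> \<open>With \<Phi>(x) as \<alpha>, the two coset lemmas have the same right-hand side,
    which makes the cosets equal; membership in that set is the criterion for an
    automorphism.\<close>
  ultimately show ?thesis
    using l_coset_Aut_framework[of x "\<Phi> x" G p] r_coset_Aut_framework[of "\<Phi> x" G x p]
    unfolding Aut_simps by blast
qed

end
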